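(* Let $n,H\in\mathbb{N}_0$. The following assertions are equivalent: (i) $\mathrm{ht}(n)\ge H$; (ii) $I(n)\ge(q-1)H$; (iii) there exists $s\in\{0,1,\dots,f-1\}$ such that for all $i=1,2,\dots,f$ the inequality $\ell^{(i)}(n^{\sigma_s})\ge(p^i-1)H$ holds.
   Context: $q=p^f$ is a power of the prime $p$, $f\ge1$; $\mathbb{N}_0=\{0,1,2,\dots\}$, $F=\{0,\dots,f-1\}$. For $a,b\in\mathbb{N}_0$ with base-$p$ digits $a_j,b_j$, $a<_pb$ means $a_j\le b_j$ for all $j$; $a\prec b$ means $a<_pb$ and $a\equiv b\pmod{q-1}$. The height $\mathrm{ht}(n)$ is the maximal $h$ for which there are pairwise distinct $0=n_0\prec n_1\prec\cdots\prec n_h<_pn$. For $n=\sum_ja_jp^j$ (base $p$) and $i\in F$ put $\ell_i(n)=\sum_{j\equiv i\,(\mathrm{mod}\,f)}a_j$; $\ell(n)=\sum_{i\in F}\ell_i(n)p^i$ (the $q$-adic digit sum of $n$); and $\ell^{(i)}(n)=\sum_{0\le j<i}\ell_j(n)p^j$ for $1\le i\le f$. For $s\in F$, $n^{\sigma_s}$ is obtained from $n$ by replacing each $q$-adic digit $b=\sum_{i\in F}a_ip^i$ ($a_i\in\{0,\dots,p-1\}$) by $\sum_{i\in F}a_{(i+s)\bmod f}\,p^i$. The indicator function is $I(n)=\min_{s\in F}\ell(n^{\sigma_s})$. *)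

theory Defs
  imports "HOL-Number_Theory.Cong"
begin

text \<open>Throughout, \<open>p\<close> is a prime, \<open>f \<ge> 1\<close>, and \<open>q = p ^ f\<close>.\<close>

definition base_digit :: "nat \<Rightarrow> nat \<Rightarrow> nat \<Rightarrow> nat" where
  "base_digit b n j = n div b ^ j mod b"

definition digit_le :: "nat \<Rightarrow> nat \<Rightarrow> nat \<Rightarrow> bool" where
  "digit_le p a b \<longleftrightarrow> (\<forall>j. base_digit p a j \<le> base_digit p b j)"

definition prec :: "nat \<Rightarrow> nat \<Rightarrow> nat \<Rightarrow> nat \<Rightarrow> bool" where
  "prec p f a b \<longleftrightarrow> digit_le p a b \<and> [a = b] (mod (p ^ f - 1))"

definition height_chain :: "nat \<Rightarrow> nat \<Rightarrow> nat \<Rightarrow> nat \<Rightarrow> (nat \<Rightarrow> nat) \<Rightarrow> bool" where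
  "height_chain p f n h c \<longleftrightarrow>
     c 0 = 0 \<and> inj_on c {..h} \<and> (\<forall>i<h. prec p f (c i) (c (Suc i))) \<and> digit_le p (c h) n"

text \<open>The last link of a chain only requires \<open>digit_le\<close>, not \<open>prec\<close>. The maximum is over
  a finite nonempty set, see \<open>finite_heights\<close> and \<open>heights_nonempty\<close> below.\<close>
definition ht :: "nat \<Rightarrow> nat \<Rightarrow> nat \<Rightarrow> nat" where
  "ht p f n = Max {h. \<exists>c. height_chain p f n h c}"

text \<open>The sums over all digit positions are restricted to the finitely many nonzero digits,
  since \<open>sum\<close> over an infinite set is \<open>0\<close>.\<close>
definition ell_comp :: "nat \<Rightarrow> nat \<Rightarrow> nat \<Rightarrow> nat \<Rightarrow> nat" where
  "ell_comp p f i n =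
     (\<Sum>j | base_digit p n j \<noteq> 0 \<and> [j = i] (mod f). base_digit p n j)"

definition ell :: "nat \<Rightarrow> nat \<Rightarrow> nat \<Rightarrow> nat" where
  "ell p f n = (\<Sum>i<f. ell_comp p f i n * p ^ i)"

definition ell_part :: "nat \<Rightarrow> nat \<Rightarrow> nat \<Rightarrow> nat \<Rightarrow> nat" where
  "ell_part p f i n = (\<Sum>j<i. ell_comp p f j n * p ^ j)"

definition rotate_digit :: "nat \<Rightarrow> nat \<Rightarrow> nat \<Rightarrow> nat \<Rightarrow> nat" where
  "rotate_digit p f s b = (\<Sum>i<f. base_digit p b ((i + s) mod f) * p ^ i)"

text \<open>\<open>sigma p f s n\<close> is $n^{\sigma_s}$; zero digits are left out of the sum because
  they are rotated to zero.\<close>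
definition sigma :: "nat \<Rightarrow> nat \<Rightarrow> nat \<Rightarrow> nat \<Rightarrow> nat" where
  "sigma p f s n =
     (\<Sum>k | base_digit (p ^ f) n k \<noteq> 0. rotate_digit p f s (base_digit (p ^ f) n k) * (p ^ f) ^ k)"

definition indicator_fn :: "nat \<Rightarrow> nat \<Rightarrow> nat \<Rightarrow> nat" where
  "indicator_fn p f n = Min ((\<lambda>s. ell p f (sigma p f s n)) ` {..<f})"

lemma digit_le_imp_le:
  assumes "p \<ge> 2" "digit_le p a b"
  shows "a \<le> b"
  using assms(2)
proof (induction a arbitrary: b rule: less_induct)
  case (less a)
  show ?case
  proof (cases "a = 0")
    case False
    have "digit_le p (a div p) (b div p)"
      unfolding digit_le_def base_digit_def
    proof
      fix j
      have "a div p ^ Suc j mod p \<le> b div p ^ Suc j mod p"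
        using less.prems unfolding digit_le_def base_digit_def by blast
      then show "a div p div p ^ j mod p \<le> b div p div p ^ j mod p"
        by (simp add: div_mult2_eq)
    qed
    moreover have "a div p < a" using False assms(1) by simp
    ultimately have "a div p \<le> b div p" using less.IH by blast
    then have "a div p * p \<le> b div p * p" by simp
    moreover have "a mod p \<le> b mod p"
      using less.prems unfolding digit_le_def base_digit_def by (drule_tac x = 0 in spec) simp
    ultimately have "a div p * p + a mod p \<le> b div p * p + b mod p" by linarith
    then show ?thesis by simp
  qed simp
qed

lemma finite_nonzero_digits:
  assumes "b \<ge> 2"
  shows "finite {j. base_digit b n j \<noteq> 0}"
proof (rule finite_subset)
  show "{j. base_digit b n j \<noteq> 0} \<subseteq> {..n}"
  proof
    fix j assume "j \<in> {j. base_digit b n j \<noteq> 0}"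
    then have "\<not> n < b ^ j" unfolding base_digit_def by auto
    then have "b ^ j \<le> n" by simp
    moreover have "j < b ^ j" using assms by (simp add: power_gt_expt)
    ultimately show "j \<in> {..n}" by simp
  qed
qed simp

lemma finite_heights:
  assumes "p \<ge> 2"
  shows "finite {h. \<exists>c. height_chain p f n h c}"
proof (rule finite_subset)
  show "{h. \<exists>c. height_chain p f n h c} \<subseteq> {..n}"
  proof
    fix h assume "h \<in> {h. \<exists>c. height_chain p f n h c}"
    then obtain c where c: "height_chain p f n h c" by blast
    have link: "c i \<le> c (Suc i)" if "i < h" for i
      using c that digit_le_imp_le[OF assms] unfolding height_chain_def prec_def by blast
    have mono: "c i \<le> c h" if "i \<le> h" for i
      using that
    proof (induction i rule: inc_induct)
      case (step m)
      then show ?case using link le_trans by blast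
    qed simp
    have "c h \<le> n"
      using c digit_le_imp_le[OF assms] unfolding height_chain_def by blast
    then have "c ` {..h} \<subseteq> {..n}" using mono le_trans by blast
    then have "card {..h} \<le> card {..n}"
      using c unfolding height_chain_def by (intro card_inj_on_le) auto
    then show "h \<in> {..n}" by simp
  qed
qed simp

lemma heights_nonempty: "{h. \<exists>c. height_chain p f n h c} \<noteq> {}"
proof -
  have "height_chain p f n 0 (\<lambda>_. 0)"
    unfolding height_chain_def digit_le_def base_digit_def by simp
  then show ?thesis by blast
qed

end

theory Submission
  imports Defs
begin

text \<open>
  Everything depends on \<open>n\<close> only through the vector of its digit sums \<open>ell_comp p f i n\<close>,
  \<open>i < f\<close>. Write \<open>q = p ^ f\<close>. Since \<open>p ^ j\<close> depends modulo \<open>q - 1\<close> only on \<open>j mod f\<close>, the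
  number \<open>p ^ s * ell p f (sigma p f s n)\<close> is congruent to \<open>n\<close> for every \<open>s\<close>
  (\<open>cong_ell_sigma\<close>).

  From chains to indicators: along a chain all the numbers \<open>ell p f (sigma p f s (c k))\<close> are
  congruent modulo \<open>q - 1\<close>, because \<open>p\<close> is invertible there. They also increase strictly, so
  they increase by at least \<open>q - 1\<close> at each link.

  From indicators to partial sums: this is a cycle lemma (\<open>exists_good_rotation\<close>).
  Extending \<open>ell_comp p f i n - (p - 1) * H\<close> periodically in \<open>i\<close> and weighting it by \<open>p ^ i\<close>,
  one obtains the steps of a walk; the bound on all \<open>ell p f (sigma p f s n)\<close> says that it never
  ends a full period lower than it started. A rotation starting at the lowest point of one period
  therefore has nonnegative partial sums.

  From partial sums to chains: regard a unit in a digit at position \<open>j\<close> as a coin of value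
  \<open>p ^ i\<close>, with \<open>i\<close> the rotated residue of \<open>j\<close>. The inequalities on partial sums say exactly
  that \<open>H\<close> boxes of value \<open>q - 1\<close> can be filled simultaneously by going through the coins in
  the order of their values (\<open>coin_packing\<close>). Adding the boxes one at a time gives the numbers
  of a chain (\<open>exists_subdigit_chain\<close>).
\<close>

section \<open>Digit expansions\<close>

lemma base_digit_eq_0:
  assumes "b \<ge> 2" "n \<le> j"
  shows "base_digit b n j = 0"
proof -
  have "j < b ^ j" using assms(1) by (simp add: power_gt_expt)
  then show ?thesis using assms(2) by (simp add: base_digit_def)
qed

lemma sum_base_digits_mod: "(\<Sum>j<N. base_digit b n j * b ^ j) = n mod b ^ N"
proof (induction N)
  case (Suc N)
  have "n mod b ^ Suc N = b ^ N * (n div b ^ N mod b) + n mod b ^ N"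
    by (metis mod_mult2_eq power_Suc2)
  then show ?case using Suc by (simp add: base_digit_def)
qed simp

lemma sum_base_digits:
  assumes "b \<ge> 2" "n \<le> N"
  shows "(\<Sum>j<N. base_digit b n j * b ^ j) = n"
proof -
  have "N < b ^ N" using assms(1) by (simp add: power_gt_expt)
  then show ?thesis using assms(2) by (simp add: sum_base_digits_mod)
qed

lemma base_digit_sum:
  assumes "\<And>j. j < N \<Longrightarrow> d j < b"
  shows "base_digit b (\<Sum>j<N. d j * b ^ j) k = (if k < N then d k else 0)"
  using assms
proof (induction N arbitrary: d k)
  case 0
  then show ?case by (simp add: base_digit_def)
next
  case (Suc N)
  let ?y = "\<Sum>j<N. d (Suc j) * b ^ j"
  have d0: "d 0 < b" using Suc.prems by simp
  have split: "(\<Sum>j<Suc N. d j * b ^ j) = d 0 + b * ?y"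
    unfolding sum.lessThan_Suc_shift by (simp add: sum_distrib_left mult_ac)
  show ?case
  proof (cases k)
    case 0
    then show ?thesis unfolding split using d0 by (simp add: base_digit_def)
  next
    case (Suc k')
    have "base_digit b (d 0 + b * ?y) (Suc k') = base_digit b ?y k'"
      using d0 by (simp add: base_digit_def div_mult2_eq)
    also have "\<dots> = (if k' < N then d (Suc k') else 0)"
      by (rule Suc.IH) (use Suc.prems in simp)
    finally show ?thesis unfolding split using Suc by simp
  qed
qed

lemma base_digit_power:
  assumes "p > 0" "i < f"
  shows "base_digit p (base_digit (p ^ f) m k) i = base_digit p m (k * f + i)"
proof -
  let ?x = "m div p ^ (k * f)"
  have pf: "p ^ f = p ^ i * p ^ (f - i)" using assms(2) by (simp flip: power_add)
  have dvd: "p dvd p ^ (f - i)" using assms by simp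
  have "(?x mod p ^ f) div p ^ i mod p = ?x div p ^ i mod p ^ (f - i) mod p"
    unfolding pf mod_mult2_eq using assms(1) by simp
  also have "\<dots> = ?x div p ^ i mod p" using dvd by (rule mod_mod_cancel)
  finally show ?thesis
    unfolding base_digit_def power_add div_mult2_eq power_mult[symmetric]
    by (simp add: mult.commute)
qed

lemma digit_le_trans: "digit_le p a b \<Longrightarrow> digit_le p b c \<Longrightarrow> digit_le p a c"
  unfolding digit_le_def using le_trans by blast

section \<open>Digit sums along residue classes\<close>

lemma ell_comp_eq_sum:
  assumes "p \<ge> 2" "i < f" "n \<le> K"
  shows "ell_comp p f i n = (\<Sum>k<K. base_digit p n (k * f + i))"
proof -
  have zero: "base_digit p n (k * f + i) = 0" if "K \<le> k" for k
  proof (rule base_digit_eq_0[OF assms(1)])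
    have "k \<le> k * f" using assms(2) by simp
    then show "n \<le> k * f + i" using that assms(3) by linarith
  qed
  have "ell_comp p f i n
      = (\<Sum>k | base_digit p n (k * f + i) \<noteq> 0. base_digit p n (k * f + i))"
    unfolding ell_comp_def
  proof (rule sum.reindex_bij_witness[where j = "\<lambda>j. j div f" and i = "\<lambda>k. k * f + i"])
    fix j assume j: "j \<in> {j. base_digit p n j \<noteq> 0 \<and> [j = i] (mod f)}"
    then have "j mod f = i" using assms(2) by (simp add: cong_def)
    then show eq: "j div f * f + i = j" by (metis div_mult_mod_eq)
    then show "j div f \<in> {k. base_digit p n (k * f + i) \<noteq> 0}" using j by simp
    show "base_digit p n (j div f * f + i) = base_digit p n j" using eq by simp
  qed (use assms(2) in \<open>auto simp: cong_def\<close>)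
  also have "\<dots> = (\<Sum>k<K. base_digit p n (k * f + i))"
  proof (rule sum.mono_neutral_left)
    show "{k. base_digit p n (k * f + i) \<noteq> 0} \<subseteq> {..<K}"
      using zero by (metis (mono_tags, lifting) lessThan_iff linorder_not_le mem_Collect_eq subsetI)
  qed auto
  finally show ?thesis .
qed

lemma ell_comp_mono:
  assumes "p \<ge> 2" "i < f" "digit_le p a b"
  shows "ell_comp p f i a \<le> ell_comp p f i b"
proof -
  have "a \<le> b" using digit_le_imp_le assms by blast
  then show ?thesis
    using assms by (auto simp: ell_comp_eq_sum[where K = b] digit_le_def intro: sum_mono)
qed

lemma digit_le_ell_comp_inject:
  assumes "p \<ge> 2" "f \<ge> 1" "digit_le p a b"
    and eq: "\<And>i. i < f \<Longrightarrow> ell_comp p f i a = ell_comp p f i b"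
  shows "a = b"
proof -
  have ab: "a \<le> b" using digit_le_imp_le assms by blast
  have "base_digit p a j = base_digit p b j" if "j < b" for j
  proof -
    let ?i = "j mod f"
    have i: "?i < f" using assms(2) by simp
    have k: "j div f < b" using that by (meson div_le_dividend le_less_trans)
    have "(\<Sum>k<b. base_digit p a (k * f + ?i)) = (\<Sum>k<b. base_digit p b (k * f + ?i))"
      using eq[OF i] assms(1) i ab by (simp add: ell_comp_eq_sum[where K = b])
    then have "base_digit p a (j div f * f + ?i) = base_digit p b (j div f * f + ?i)"
      by (rule sum_mono_inv) (use assms(3) k in \<open>auto simp: digit_le_def\<close>)
    then show ?thesis by simp
  qed
  then have "(\<Sum>j<b. base_digit p a j * p ^ j) = (\<Sum>j<b. base_digit p b j * p ^ j)"
    by (intro sum.cong) auto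
  then show ?thesis using sum_base_digits[OF assms(1)] ab by simp
qed

lemma exists_bounded_sum_eq:
  fixes a :: "'a \<Rightarrow> nat"
  assumes "finite A" "y \<le> sum a A"
  shows "\<exists>b. (\<forall>k. b k \<le> a k) \<and> sum b A = y"
  using assms
proof (induction A arbitrary: y rule: finite_induct)
  case empty
  then show ?case by (intro exI[of _ "\<lambda>_. 0"]) simp
next
  case (insert k A)
  have "y - min y (a k) \<le> sum a A" using insert by simp
  then obtain b where b: "\<forall>k. b k \<le> a k" "sum b A = y - min y (a k)"
    using insert.IH by blast
  have "sum (b(k := min y (a k))) A = sum b A"
    using insert.hyps by (intro sum.cong) auto
  then show ?case
    using b insert.hyps by (intro exI[of _ "b(k := min y (a k))"]) auto
qed

text \<open>The residue classes modulo \<open>f\<close> are disjoint, so the digits can be lowered in each class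
  independently.\<close>
lemma exists_digit_le_with_ell_comp:
  assumes "p \<ge> 2" "f \<ge> 1" and y: "\<And>i. i < f \<Longrightarrow> y i \<le> ell_comp p f i m"
  shows "\<exists>m'. digit_le p m' m \<and> (\<forall>i<f. ell_comp p f i m' = y i)"
proof -
  have "\<exists>b. (\<forall>k. b k \<le> base_digit p m (k * f + i)) \<and> sum b {..<m} = y i" if "i < f" for i
    using exists_bounded_sum_eq[of "{..<m}" "y i" "\<lambda>k. base_digit p m (k * f + i)"]
      y[OF that] ell_comp_eq_sum[OF assms(1) that order_refl] by simp
  then obtain b where b: "\<And>i k. i < f \<Longrightarrow> b i k \<le> base_digit p m (k * f + i)"
    and sum_b: "\<And>i. i < f \<Longrightarrow> sum (b i) {..<m} = y i"
    by metis
  define d where "d j = b (j mod f) (j div f)" for j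
  have d_le: "d j \<le> base_digit p m j" for j
    using b[of "j mod f" "j div f"] assms(2) by (simp add: d_def)
  have d_less: "d j < p" for j
  proof -
    have "base_digit p m j < p" using assms(1) by (simp add: base_digit_def)
    then show ?thesis using d_le[of j] by linarith
  qed
  define m' where "m' = (\<Sum>j<m * f. d j * p ^ j)"
  have digit: "base_digit p m' j = (if j < m * f then d j else 0)" for j
    unfolding m'_def using d_less by (intro base_digit_sum) simp
  have le: "digit_le p m' m" using digit d_le by (simp add: digit_le_def)
  have "ell_comp p f i m' = y i" if i: "i < f" for i
  proof -
    have "m' \<le> m" using digit_le_imp_le assms(1) le by blast
    then have "ell_comp p f i m' = (\<Sum>k<m. base_digit p m' (k * f + i))"
      using ell_comp_eq_sum assms(1) i by blast
    also have "\<dots> = (\<Sum>k<m. b i k)"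
    proof (rule sum.cong)
      fix k assume "k \<in> {..<m}"
      then have "Suc k * f \<le> m * f" by (intro mult_right_mono) auto
      then have "k * f + i < m * f" using i by simp
      then show "base_digit p m' (k * f + i) = b i k" using i by (simp add: digit d_def)
    qed simp
    finally show ?thesis using sum_b i by simp
  qed
  then show ?thesis using le by blast
qed

lemma exists_subdigit_chain:
  assumes "p \<ge> 2" "f \<ge> 1"
    and "\<And>k i. k < H \<Longrightarrow> i < f \<Longrightarrow> y k i \<le> y (Suc k) i"
    and "\<And>i. i < f \<Longrightarrow> y H i \<le> ell_comp p f i n"
  shows "\<exists>c. (\<forall>k<H. digit_le p (c k) (c (Suc k))) \<and> digit_le p (c H) n \<and>
             (\<forall>k\<le>H. \<forall>i<f. ell_comp p f i (c k) = y k i)"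
  using assms(3,4)
proof (induction H arbitrary: n)
  case 0
  then obtain m where "digit_le p m n" "\<forall>i<f. ell_comp p f i m = y 0 i"
    using exists_digit_le_with_ell_comp[OF assms(1,2), of "y 0" n] by blast
  then show ?case by (intro exI[of _ "\<lambda>_. m"]) simp
next
  case (Suc H)
  obtain m where m: "digit_le p m n" "\<forall>i<f. ell_comp p f i m = y (Suc H) i"
    using exists_digit_le_with_ell_comp[OF assms(1,2), of "y (Suc H)" n] Suc.prems(2) by blast
  obtain c where c: "\<forall>k<H. digit_le p (c k) (c (Suc k))" "digit_le p (c H) m"
    "\<forall>k\<le>H. \<forall>i<f. ell_comp p f i (c k) = y k i"
    using Suc.IH[of m] Suc.prems(1) m(2) by auto
  show ?case
    by (rule exI[of _ "c(Suc H := m)"]) (use c m in \<open>auto simp: less_Suc_eq le_Suc_eq\<close>)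
qed

section \<open>Rotated weights\<close>

text \<open>The rotation acts inside the blocks of \<open>f\<close> consecutive \<open>p\<close>-adic digits, so it permutes
  the residue classes and keeps the block of each digit.\<close>
lemma base_digit_sigma:
  assumes "p \<ge> 2" "f \<ge> 1" "i < f"
  shows "base_digit p (sigma p f s n) (k * f + i) = base_digit p n (k * f + (i + s) mod f)"
proof -
  have q: "p ^ f \<ge> 2"
  proof -
    have "p \<le> p ^ f" using assms(1,2) by (intro self_le_power) auto
    then show ?thesis using assms(1) by simp
  qed
  have p0: "0 < p" using assms(1) by simp
  have digit_less: "base_digit p b j < p" for b j
    using p0 by (simp add: base_digit_def)
  let ?r = "\<lambda>b. rotate_digit p f s b"
  let ?d = "\<lambda>k. base_digit (p ^ f) n k"
  have digit_r: "base_digit p (?r b) i = base_digit p b ((i + s) mod f)" if "i < f" for b i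
    unfolding rotate_digit_def using digit_less that by (subst base_digit_sum) auto
  have r_less: "?r b < p ^ f" for b
  proof -
    have "?r b = (\<Sum>j<f. base_digit p (?r b) j * p ^ j)"
      using digit_r by (subst (1) rotate_digit_def) (intro sum.cong, auto)
    then show ?thesis
      using p0 by (metis sum_base_digits_mod mod_less_divisor zero_less_power)
  qed
  have r0: "?r 0 = 0" by (simp add: rotate_digit_def base_digit_def)
  have "sigma p f s n = (\<Sum>l<max n (Suc k). ?r (?d l) * (p ^ f) ^ l)"
    unfolding sigma_def
  proof (rule sum.mono_neutral_left)
    show "{l. ?d l \<noteq> 0} \<subseteq> {..<max n (Suc k)}"
    proof
      fix l assume "l \<in> {l. ?d l \<noteq> 0}"
      then have "\<not> n \<le> l" using base_digit_eq_0[OF q] by auto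
      then show "l \<in> {..<max n (Suc k)}" by simp
    qed
  qed (auto simp: r0)
  then have "base_digit (p ^ f) (sigma p f s n) k = ?r (?d k)"
    using r_less by (simp add: base_digit_sum)
  then have "base_digit p (sigma p f s n) (k * f + i) = base_digit p (?d k) ((i + s) mod f)"
    using digit_r assms(3) base_digit_power[OF p0 assms(3), of "sigma p f s n" k] by simp
  then show ?thesis using assms(2) p0 by (simp add: base_digit_power)
qed

lemma ell_comp_sigma:
  assumes "p \<ge> 2" "i < f"
  shows "ell_comp p f i (sigma p f s n) = ell_comp p f ((i + s) mod f) n"
proof -
  have "(i + s) mod f < f" "f \<ge> 1" using assms(2) by auto
  then show ?thesis
    using assms
      ell_comp_eq_sum[OF assms, of "sigma p f s n" "max n (sigma p f s n)"]
      ell_comp_eq_sum[of p "(i + s) mod f" f n "max n (sigma p f s n)"]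
    by (simp add: base_digit_sigma)
qed

lemma ell_part_sigma:
  assumes "p \<ge> 2" "i \<le> f"
  shows "ell_part p f i (sigma p f s n) = (\<Sum>j<i. ell_comp p f ((j + s) mod f) n * p ^ j)"
  unfolding ell_part_def using assms by (intro sum.cong) (auto simp: ell_comp_sigma)

lemma ell_eq_ell_part: "ell p f n = ell_part p f f n"
  by (simp add: ell_def ell_part_def)

lemma shift_back_mod: "(j + f - s) mod f < f" "((j + f - s) mod f + s) mod f = j"
  if "s < f" "j < f" for f j s :: nat
  using that by (auto simp: mod_add_left_eq)

lemma shift_mod_back: "((i + s) mod f + f - s) mod f = i" if "s < f" "i < f" for f i s :: nat
proof (cases "i + s < f")
  case False
  then have "(i + s) mod f = i + s - f" using that by (simp add: le_mod_geq)
  then show ?thesis using that False by simp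
qed (use that in simp)

lemma ell_sigma_strict_mono:
  assumes "p \<ge> 2" "s < f" "digit_le p a b" "a \<noteq> b"
  shows "ell p f (sigma p f s a) < ell p f (sigma p f s b)"
proof -
  have f: "f \<ge> 1" using assms(2) by simp
  have pos: "0 < p ^ i" for i using assms(1) by simp
  obtain j where j: "j < f" "ell_comp p f j a \<noteq> ell_comp p f j b"
    using digit_le_ell_comp_inject assms f by blast
  then have "ell_comp p f j a < ell_comp p f j b"
    using ell_comp_mono[OF assms(1) j(1) assms(3)] by simp
  then have "\<exists>i\<in>{..<f}. ell_comp p f ((i + s) mod f) a * p ^ i
                      < ell_comp p f ((i + s) mod f) b * p ^ i"
    using shift_back_mod[OF assms(2) j(1)] pos
    by (intro bexI[of _ "(j + f - s) mod f"]) auto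
  then show ?thesis
    unfolding ell_eq_ell_part ell_part_sigma[OF assms(1) order_refl]
    using ell_comp_mono[OF assms(1) _ assms(3)] f
    by (intro sum_strict_mono_ex1) auto
qed

lemma ell_sigma_mono:
  assumes "p \<ge> 2" "s < f" "digit_le p a b"
  shows "ell p f (sigma p f s a) \<le> ell p f (sigma p f s b)"
  using ell_sigma_strict_mono[OF assms] by (cases "a = b") auto

lemma cong_power_mod_exponent:
  fixes p :: nat
  assumes "p \<ge> 1"
  shows "[p ^ j = p ^ (j mod f)] (mod (p ^ f - 1))"
proof -
  have "[p ^ f = 1] (mod (p ^ f - 1))"
    using assms by (metis cong_diff_iff_cong_0_nat cong_mult_self_right cong_0_iff dvd_refl one_le_power)
  then have "[(p ^ f) ^ (j div f) * p ^ (j mod f) = 1 ^ (j div f) * p ^ (j mod f)]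
      (mod (p ^ f - 1))"
    by (intro cong_mult cong_pow cong_refl)
  then show ?thesis by (simp flip: power_mult power_add)
qed

text \<open>This is casting out nines in base \<open>q = p ^ f\<close>, since \<open>ell p f n\<close> is the \<open>q\<close>-adic digit
  sum of \<open>n\<close>.\<close>
lemma cong_ell:
  assumes "p \<ge> 2" "f \<ge> 1"
  shows "[ell p f n = n] (mod (p ^ f - 1))"
proof -
  have "ell p f n = (\<Sum>i<f. \<Sum>k<n. base_digit p n (k * f + i) * p ^ i)"
    using assms(1) by (simp add: ell_def ell_comp_eq_sum[where K = n] sum_distrib_right)
  also have "\<dots> = (\<Sum>k<n. \<Sum>i<f. base_digit p n (k * f + i) * p ^ i)"
    by (rule sum.swap)
  also have "[\<dots> = (\<Sum>k<n. \<Sum>i<f. base_digit p n (k * f + i) * p ^ (k * f + i))]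
      (mod (p ^ f - 1))"
  proof (intro cong_sum cong_mult cong_refl)
    fix k i assume "i \<in> {..<f}"
    then show "[p ^ i = p ^ (k * f + i)] (mod (p ^ f - 1))"
      using cong_power_mod_exponent[of p "k * f + i" f] assms by (simp add: cong_sym)
  qed
  also have "(\<Sum>k<n. \<Sum>i<f. base_digit p n (k * f + i) * p ^ (k * f + i))
      = (\<Sum>j<n * f. base_digit p n j * p ^ j)"
  proof -
    have "(\<Sum>i<f. base_digit p n (k * f + i) * p ^ (k * f + i))
        = (\<Sum>j = k * f..<k * f + f. base_digit p n j * p ^ j)" for k
      by (rule sum.reindex_bij_witness[where i = "\<lambda>j. j - k * f" and j = "\<lambda>i. k * f + i"]) auto
    then show ?thesis by (simp add: sum.nat_group)
  qed
  also have "\<dots> = n" using assms by (simp add: sum_base_digits)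
  finally show ?thesis .
qed

lemma cong_ell_sigma:
  assumes "p \<ge> 2" "s < f"
  shows "[p ^ s * ell p f (sigma p f s n) = n] (mod (p ^ f - 1))"
proof -
  have "p ^ s * ell p f (sigma p f s n)
      = (\<Sum>i<f. ell_comp p f ((i + s) mod f) n * p ^ (i + s))"
    unfolding ell_eq_ell_part ell_part_sigma[OF assms(1) order_refl]
    by (simp add: sum_distrib_left power_add mult_ac)
  also have "[\<dots> = (\<Sum>i<f. ell_comp p f ((i + s) mod f) n * p ^ ((i + s) mod f))]
      (mod (p ^ f - 1))"
    using assms(1) by (intro cong_sum cong_mult cong_refl cong_power_mod_exponent) auto
  also have "(\<Sum>i<f. ell_comp p f ((i + s) mod f) n * p ^ ((i + s) mod f)) = ell p f n"
    unfolding ell_def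
    by (rule sum.reindex_bij_witness
        [where j = "\<lambda>i. (i + s) mod f" and i = "\<lambda>j. (j + f - s) mod f"])
      (use assms(2) shift_back_mod shift_mod_back in auto)
  also have "[ell p f n = n] (mod (p ^ f - 1))" using cong_ell assms by simp
  finally show ?thesis .
qed

section \<open>Chains bound the rotated weights\<close>

lemma ht_ge_iff:
  assumes "p \<ge> 2"
  shows "ht p f n \<ge> H \<longleftrightarrow> (\<exists>c. height_chain p f n H c)"
proof
  assume "\<exists>c. height_chain p f n H c"
  then show "ht p f n \<ge> H"
    unfolding ht_def using finite_heights[OF assms] by (intro Max_ge) auto
next
  assume H: "ht p f n \<ge> H"
  let ?h = "ht p f n"
  have "?h \<in> {h. \<exists>c. height_chain p f n h c}"
    unfolding ht_def using finite_heights[OF assms] heights_nonempty by (rule Max_in)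
  then obtain c where c: "height_chain p f n ?h c" by blast
  have "digit_le p (c H) (c ?h)"
    using H
  proof (induction H rule: inc_induct)
    case base
    show ?case by (simp add: digit_le_def)
  next
    case (step k)
    then have "digit_le p (c k) (c (Suc k))"
      using c unfolding height_chain_def prec_def by blast
    then show ?case using step.IH digit_le_trans by blast
  qed
  then have "height_chain p f n H c"
    using c H digit_le_trans unfolding height_chain_def
    by (auto intro: inj_on_subset)
  then show "\<exists>c. height_chain p f n H c" by blast
qed

lemma height_chain_ell_sigma:
  assumes "p \<ge> 2" "s < f" "height_chain p f n H c"
  shows "(p ^ f - 1) * H \<le> ell p f (sigma p f s n)"
proof -
  let ?W = "\<lambda>m. ell p f (sigma p f s m)"
  let ?M = "p ^ f - 1"
  \<comment> \<open>Invertibility of \<open>p\<close> turns the congruences between \<open>p ^ s\<close> times the weights into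
    congruences between the weights themselves.\<close>
  have cop: "coprime (p ^ s) ?M"
  proof -
    have "coprime (p ^ f) ?M"
      using assms(1) by (intro coprime_diff_one_right_nat) simp
    then have "coprime p ?M" using assms(2) by simp
    then show ?thesis by simp
  qed
  have step: "?W (c k) + ?M \<le> ?W (c (Suc k))" if k: "k < H" for k
  proof -
    have chain: "digit_le p (c k) (c (Suc k))" "[c k = c (Suc k)] (mod ?M)"
      using assms(3) k unfolding height_chain_def prec_def by auto
    have "c k \<noteq> c (Suc k)"
      using assms(3) k unfolding height_chain_def by (auto dest: inj_onD)
    then have less: "?W (c k) < ?W (c (Suc k))"
      using ell_sigma_strict_mono assms(1,2) chain(1) by blast
    have "[p ^ s * ?W (c k) = p ^ s * ?W (c (Suc k))] (mod ?M)"
      using cong_ell_sigma[OF assms(1,2)] chain(2) by (meson cong_sym cong_trans)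
    then have "[?W (c k) = ?W (c (Suc k))] (mod ?M)"
      using cop by (simp add: cong_mult_lcancel_nat)
    then have "?M dvd ?W (c (Suc k)) - ?W (c k)"
      using less by (metis cong_altdef_nat cong_sym less_imp_le_nat)
    then have "?M \<le> ?W (c (Suc k)) - ?W (c k)"
      using less by (intro dvd_imp_le) auto
    then show ?thesis using less by simp
  qed
  have "?M * k \<le> ?W (c k)" if "k \<le> H" for k
    using that
  proof (induction k)
    case (Suc k)
    then show ?case using step[of k] by simp
  qed simp
  then have "?M * H \<le> ?W (c H)" by simp
  also have "\<dots> \<le> ?W n"
    using ell_sigma_mono assms unfolding height_chain_def by blast
  finally show ?thesis .
qed

section \<open>A cycle lemma\<close>

text \<open>Here \<open>A i\<close> is the sum of the first \<open>i\<close> terms of the periodic walk with steps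
  \<open>(w (j mod f) - (p - 1) * H) * p ^ j\<close>. Its increments from \<open>s\<close> on are, up to the factor
  \<open>p ^ s\<close>, the partial sums for the rotation by \<open>s\<close>; the hypothesis says that the walk does not
  descend over a period, so its minimum over one period is a global minimum.\<close>
lemma exists_good_rotation:
  fixes p f H :: nat and w :: "nat \<Rightarrow> nat"
  assumes "p \<ge> 1" "f \<ge> 1"
    and full: "\<And>s. s < f \<Longrightarrow> (p ^ f - 1) * H \<le> (\<Sum>j<f. w ((j + s) mod f) * p ^ j)"
  shows "\<exists>s<f. \<forall>i\<le>f. (p ^ i - 1) * H \<le> (\<Sum>j<i. w ((j + s) mod f) * p ^ j)"
proof -
  define A where
    "A i = (\<Sum>j<i. (int (w (j mod f)) - (int p - 1) * int H) * int p ^ j)" for i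
  have geom: "(\<Sum>j<i. (int p - 1) * int p ^ j) = int p ^ i - 1" for i
    by (induction i) (auto simp: algebra_simps)
  have A_diff: "A (s + i) - A s
      = int p ^ s * (int (\<Sum>j<i. w ((j + s) mod f) * p ^ j) - int ((p ^ i - 1) * H))" for s i
  proof -
    have "A (s + i) - A s
        = int p ^ s * (\<Sum>j<i. (int (w ((j + s) mod f)) - (int p - 1) * int H) * int p ^ j)"
      by (induction i) (auto simp: A_def algebra_simps power_add)
    also have "(\<Sum>j<i. (int (w ((j + s) mod f)) - (int p - 1) * int H) * int p ^ j)
        = int (\<Sum>j<i. w ((j + s) mod f) * p ^ j) - (\<Sum>j<i. (int p - 1) * int p ^ j) * int H"
      unfolding left_diff_distrib[of "int (w _)"] sum_subtractf sum_distrib_right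
      by (simp add: mult_ac)
    also have "(\<Sum>j<i. (int p - 1) * int p ^ j) = int (p ^ i - 1)"
      using geom assms(1) by (simp add: of_nat_diff)
    finally show ?thesis by simp
  qed
  have p_pos: "0 < int p ^ s" for s using assms(1) by simp
  have period: "A s \<le> A (s + f)" if "s < f" for s
  proof -
    have "0 \<le> int (\<Sum>j<f. w ((j + s) mod f) * p ^ j) - int ((p ^ f - 1) * H)"
      using full[OF that] by linarith
    then have "0 \<le> A (s + f) - A s" unfolding A_diff using p_pos by simp
    then show ?thesis by simp
  qed
  obtain s where s: "s < f" "\<And>t. t < f \<Longrightarrow> A s \<le> A t"
  proof -
    have "finite {..<f}" "{..<f} \<noteq> {}" using assms(2) by (auto simp: lessThan_empty_iff)
    then show ?thesis
      using that[of "arg_min_on A {..<f}"] arg_min_if_finite(1)[of "{..<f}" A]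
        arg_min_least[of "{..<f}" _ A] by auto
  qed
  have "(p ^ i - 1) * H \<le> (\<Sum>j<i. w ((j + s) mod f) * p ^ j)" if i: "i \<le> f" for i
  proof -
    have "A s \<le> A (s + i)"
    proof (cases "s + i < f")
      case False
      let ?t = "s + i - f"
      have t: "?t < f" "s + i = ?t + f" using False s(1) i by auto
      show ?thesis using s(2)[OF t(1)] period[OF t(1)] t(2) by simp
    qed (use s in blast)
    then have "0 \<le> int p ^ s * (int (\<Sum>j<i. w ((j + s) mod f) * p ^ j) - int ((p ^ i - 1) * H))"
      using A_diff[of s i] by simp
    then have "0 \<le> int (\<Sum>j<i. w ((j + s) mod f) * p ^ j) - int ((p ^ i - 1) * H)"
      using p_pos by (simp only: zero_le_mult_iff) (metis not_less)
    then show ?thesis by linarith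
  qed
  then show ?thesis using s(1) by blast
qed

section \<open>Packing coins into boxes\<close>

text \<open>The coins going into the boxes are taken from two stocks, of \<open>a\<close> and \<open>b\<close> coins.\<close>
lemma split_bounded_sum:
  fixes z :: "nat \<Rightarrow> nat"
  assumes "(\<Sum>k<H. z k) \<le> a + b"
  shows "\<exists>u v. (\<forall>k. z k = u k + v k) \<and> (\<Sum>k<H. u k) \<le> a \<and> (\<Sum>k<H. v k) \<le> b"
proof -
  obtain u where u: "\<forall>k. u k \<le> z k" "sum u {..<H} = min a (sum z {..<H})"
    using exists_bounded_sum_eq[of "{..<H}" "min a (sum z {..<H})" z] by auto
  have "(\<Sum>k<H. z k - u k) = sum z {..<H} - sum u {..<H}"
    using u by (intro sum_subtractf_nat) auto
  then show ?thesis
    using u assms by (intro exI[of _ u] exI[of _ "\<lambda>k. z k - u k"]) auto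
qed

text \<open>There are \<open>w j\<close> coins of value \<open>p ^ j\<close>, and \<open>H\<close> boxes have to be filled to the value
  \<open>p ^ f - 1\<close>. The \<open>e\<close> extra coins of value \<open>1\<close> make the induction on \<open>f\<close> possible: each box
  receives \<open>p - 1\<close> coins of value \<open>1\<close>, the remaining ones are glued together in groups of \<open>p\<close>
  and become the extra coins of the problem in which all values are divided by \<open>p\<close>.\<close>
lemma coin_packing_with_extra:
  fixes p H f e :: nat and w :: "nat \<Rightarrow> nat"
  assumes "p \<ge> 1"
    and "\<And>i. i \<le> f \<Longrightarrow> (p ^ i - 1) * H \<le> e + (\<Sum>j<i. w j * p ^ j)"
  shows "\<exists>x r. (\<forall>j<f. (\<Sum>k<H. x k j) \<le> w j) \<and> (\<Sum>k<H. r k) \<le> e \<and>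
               (\<forall>k<H. r k + (\<Sum>j<f. x k j * p ^ j) = p ^ f - 1)"
  using assms(2)
proof (induction f arbitrary: w e)
  case 0
  show ?case by (intro exI[of _ "\<lambda>_ _. 0"] exI[of _ "\<lambda>_. 0"]) simp
next
  case (Suc f)
  have pow: "p ^ Suc i - 1 = (p - 1) + p * (p ^ i - 1)" for i
  proof -
    have "p * (p ^ i - 1) = p ^ Suc i - p" by (simp add: diff_mult_distrib2)
    moreover have "p ^ Suc i \<ge> p" using assms(1) by simp
    ultimately show ?thesis using assms(1) by linarith
  qed
  define u where "u = e + w 0 - (p - 1) * H"
  have u: "e + w 0 = (p - 1) * H + u"
    using Suc.prems[of 1] by (simp add: u_def)
  define e' where "e' = u div p"
  have "(p ^ i - 1) * H \<le> e' + (\<Sum>j<i. w (Suc j) * p ^ j)" if "i \<le> f" for i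
  proof -
    let ?S = "\<Sum>j<i. w (Suc j) * p ^ j"
    have "(p ^ Suc i - 1) * H \<le> e + (\<Sum>j<Suc i. w j * p ^ j)"
      using Suc.prems that by (meson Suc_le_mono)
    also have "(\<Sum>j<Suc i. w j * p ^ j) = w 0 + p * ?S"
      unfolding sum.lessThan_Suc_shift by (simp add: sum_distrib_left mult_ac)
    finally have "(p - 1) * H + p * ((p ^ i - 1) * H) \<le> e + w 0 + p * ?S"
      unfolding pow by (simp only: add_mult_distrib mult.assoc add.assoc)
    then have "p * ((p ^ i - 1) * H) \<le> u + p * ?S" using u by linarith
    then have "p * ((p ^ i - 1) * H) div p \<le> (u + p * ?S) div p" by (rule div_le_mono)
    then show ?thesis using assms(1) by (simp add: e'_def)
  qed
  then obtain x' r' where x': "\<And>j. j < f \<Longrightarrow> (\<Sum>k<H. x' k j) \<le> w (Suc j)"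
    and r': "(\<Sum>k<H. r' k) \<le> e'"
    and weight: "\<And>k. k < H \<Longrightarrow> r' k + (\<Sum>j<f. x' k j * p ^ j) = p ^ f - 1"
    using Suc.IH[of e' "\<lambda>j. w (Suc j)"] by blast
  have "(\<Sum>k<H. (p - 1) + p * r' k) = (p - 1) * H + p * (\<Sum>k<H. r' k)"
    by (simp add: sum.distrib sum_distrib_left mult.commute)
  also have "\<dots> \<le> (p - 1) * H + u"
    using r' mult_le_mono2[OF r', of p] times_div_less_eq_dividend[of p u]
    unfolding e'_def by linarith
  also have "\<dots> = e + w 0" using u by simp
  finally obtain r y where ry: "\<And>k. (p - 1) + p * r' k = r k + y k"
    "(\<Sum>k<H. r k) \<le> e" "(\<Sum>k<H. y k) \<le> w 0"
    using split_bounded_sum[of "\<lambda>k. (p - 1) + p * r' k" H e "w 0"] by blast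
  define x where "x k j = (case j of 0 \<Rightarrow> y k | Suc j' \<Rightarrow> x' k j')" for k j
  have "(\<Sum>k<H. x k j) \<le> w j" if "j < Suc f" for j
    using that x' ry(3) by (cases j) (auto simp: x_def)
  moreover have "r k + (\<Sum>j<Suc f. x k j * p ^ j) = p ^ Suc f - 1" if "k < H" for k
  proof -
    have "(\<Sum>j<Suc f. x k j * p ^ j) = y k + p * (\<Sum>j<f. x' k j * p ^ j)"
      unfolding sum.lessThan_Suc_shift by (simp add: x_def sum_distrib_left mult_ac)
    then have "r k + (\<Sum>j<Suc f. x k j * p ^ j)
        = (p - 1) + p * (r' k + (\<Sum>j<f. x' k j * p ^ j))"
      using ry(1)[of k] by (simp add: distrib_left)
    then show ?thesis unfolding pow weight[OF that] .
  qed
  ultimately show ?case using ry(2) by blast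
qed

lemma coin_packing:
  fixes p H f :: nat and w :: "nat \<Rightarrow> nat"
  assumes "p \<ge> 1" "\<And>i. i \<le> f \<Longrightarrow> (p ^ i - 1) * H \<le> (\<Sum>j<i. w j * p ^ j)"
  shows "\<exists>x. (\<forall>j<f. (\<Sum>k<H. x k j) \<le> w j) \<and> (\<forall>k<H. (\<Sum>j<f. x k j * p ^ j) = p ^ f - 1)"
proof -
  obtain x r where "\<forall>j<f. (\<Sum>k<H. x k j) \<le> w j" "(\<Sum>k<H. r k) \<le> 0"
    "\<forall>k<H. r k + (\<Sum>j<f. x k j * p ^ j) = p ^ f - 1"
    using coin_packing_with_extra[of p f H 0 w] assms by auto
  then show ?thesis by auto
qed

text \<open>The coins of value \<open>p ^ j\<close> are the units in the digits of \<open>n\<close> at the positions congruent to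
  \<open>j + s\<close>; the index \<open>(i + f - s) mod f\<close> below undoes this rotation.
  The \<open>k\<close>-th number of the chain takes its digits from the first \<open>k\<close> boxes, so its rotated
  weight is exactly \<open>k * (q - 1)\<close>. This value alone shows that the numbers are distinct, that
  they are divisible by \<open>q - 1\<close> (by \<open>cong_ell_sigma\<close>), and that the first one is \<open>0\<close>.\<close>
lemma exists_height_chain:
  assumes "p \<ge> 2" "s < f"
    and part: "\<And>i. i \<le> f \<Longrightarrow> (p ^ i - 1) * H \<le> (\<Sum>j<i. ell_comp p f ((j + s) mod f) n * p ^ j)"
  shows "\<exists>c. height_chain p f n H c"
proof -
  let ?M = "p ^ f - 1"
  let ?W = "\<lambda>m. ell p f (sigma p f s m)"
  have f: "f \<ge> 1" and p: "p \<ge> 1" using assms by auto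
  have M: "?M \<ge> 1"
  proof -
    have "p \<le> p ^ f" using p f by (intro self_le_power) auto
    then show ?thesis using assms(1) by simp
  qed
  obtain x where x: "\<And>j. j < f \<Longrightarrow> (\<Sum>k<H. x k j) \<le> ell_comp p f ((j + s) mod f) n"
    and weight: "\<And>k. k < H \<Longrightarrow> (\<Sum>j<f. x k j * p ^ j) = ?M"
    using coin_packing[OF p, of f H "\<lambda>j. ell_comp p f ((j + s) mod f) n"] part by blast
  define y where "y k i = (\<Sum>l<k. x l ((i + f - s) mod f))" for k i
  have "y H i \<le> ell_comp p f i n" if "i < f" for i
    using x[of "(i + f - s) mod f"] shift_back_mod[OF assms(2) that] by (simp add: y_def)
  moreover have "y k i \<le> y (Suc k) i" for k i by (simp add: y_def)
  ultimately obtain c where c: "\<forall>k<H. digit_le p (c k) (c (Suc k))" "digit_le p (c H) n"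
    and ell_c: "\<And>k i. k \<le> H \<Longrightarrow> i < f \<Longrightarrow> ell_comp p f i (c k) = y k i"
    using exists_subdigit_chain[OF assms(1) f, of H y n] by blast
  have W: "?W (c k) = k * ?M" if "k \<le> H" for k
  proof -
    have "?W (c k) = (\<Sum>j<f. y k ((j + s) mod f) * p ^ j)"
      unfolding ell_eq_ell_part ell_part_sigma[OF assms(1) order_refl]
      using that f by (intro sum.cong) (auto simp: ell_c)
    also have "\<dots> = (\<Sum>j<f. \<Sum>l<k. x l j * p ^ j)"
      using assms(2) by (intro sum.cong) (auto simp: y_def shift_mod_back sum_distrib_right)
    also have "\<dots> = (\<Sum>l<k. \<Sum>j<f. x l j * p ^ j)" by (rule sum.swap)
    also have "\<dots> = (\<Sum>l<k. ?M)" using weight that by (intro sum.cong) auto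
    finally show ?thesis by simp
  qed
  have zero: "[c k = 0] (mod ?M)" if "k \<le> H" for k
  proof -
    have "[c k = p ^ s * (k * ?M)] (mod ?M)"
      using cong_ell_sigma[OF assms(1,2), of "c k"] W[OF that] by (simp add: cong_sym)
    moreover have "[p ^ s * (k * ?M) = 0] (mod ?M)" by (simp add: cong_0_iff)
    ultimately show ?thesis by (rule cong_trans)
  qed
  have "c 0 = 0"
  proof (rule ccontr)
    assume "c 0 \<noteq> 0"
    moreover have "digit_le p 0 (c 0)" by (simp add: digit_le_def base_digit_def)
    ultimately have "?W 0 < ?W (c 0)"
      using ell_sigma_strict_mono assms(1,2) by metis
    then show False using W[of 0] by simp
  qed
  moreover have "inj_on c {..H}"
  proof (rule inj_onI)
    fix k l assume "k \<in> {..H}" "l \<in> {..H}" "c k = c l"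
    then have "k * ?M = l * ?M" using W by (metis atMost_iff)
    then show "k = l" using M by (metis mult_right_cancel not_one_le_zero)
  qed
  moreover have "prec p f (c k) (c (Suc k))" if "k < H" for k
    unfolding prec_def using c(1) zero[of k] zero[of "Suc k"] that
    by (auto intro: cong_trans cong_sym)
  ultimately have "height_chain p f n H c"
    unfolding height_chain_def using c(2) by blast
  then show ?thesis by blast
qed

section \<open>The equivalence\<close>

lemma indicator_fn_ge_iff:
  assumes "f \<ge> 1"
  shows "indicator_fn p f n \<ge> X \<longleftrightarrow> (\<forall>s<f. X \<le> ell p f (sigma p f s n))"
  unfolding indicator_fn_def using assms by (subst Min_ge_iff) (auto simp: lessThan_empty_iff)

theorem theorem3p8:
  fixes p f n H :: nat
  assumes "prime p" and "f \<ge> 1"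
  shows "(ht p f n \<ge> H \<longleftrightarrow> indicator_fn p f n \<ge> (p ^ f - 1) * H) \<and>
         (indicator_fn p f n \<ge> (p ^ f - 1) * H \<longleftrightarrow>
            (\<exists>s\<in>{0..<f}. \<forall>i\<in>{1..f}. ell_part p f i (sigma p f s n) \<ge> (p ^ i - 1) * H))"
    (is "(?i \<longleftrightarrow> ?ii) \<and> (?ii \<longleftrightarrow> ?iii)")
proof -
  have p: "p \<ge> 2" using assms(1) by (rule prime_ge_2_nat)
  have "?ii" if ?i
    using that height_chain_ell_sigma[OF p] assms(2)
    unfolding ht_ge_iff[OF p] indicator_fn_ge_iff[OF assms(2)] by blast
  moreover have "?iii" if ?ii
  proof -
    have "(p ^ f - 1) * H \<le> (\<Sum>j<f. ell_comp p f ((j + s) mod f) n * p ^ j)" if "s < f" for s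
      using \<open>?ii\<close> that unfolding indicator_fn_ge_iff[OF assms(2)]
      by (simp add: ell_eq_ell_part ell_part_sigma p)
    then obtain s where "s < f"
      "\<forall>i\<le>f. (p ^ i - 1) * H \<le> (\<Sum>j<i. ell_comp p f ((j + s) mod f) n * p ^ j)"
      using exists_good_rotation[of p f H "\<lambda>i. ell_comp p f i n"] p assms(2) by auto
    then show ?thesis
      using p by (intro bexI[of _ s]) (auto simp: ell_part_sigma)
  qed
  moreover have "?i" if ?iii
  proof -
    obtain s where s: "s < f"
      "\<And>i. i \<in> {1..f} \<Longrightarrow> (p ^ i - 1) * H \<le> ell_part p f i (sigma p f s n)"
      using \<open>?iii\<close> by auto
    have "(p ^ i - 1) * H \<le> (\<Sum>j<i. ell_comp p f ((j + s) mod f) n * p ^ j)" if "i \<le> f" for i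
      using s(2)[of i] that p by (cases "i = 0") (auto simp: ell_part_sigma)
    then show ?thesis
      unfolding ht_ge_iff[OF p] by (rule exists_height_chain[OF p s(1)])
  qed
  ultimately show ?thesis by blast
qed

end
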